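(* Let $(\Sigma,\sigma)$ be a countable Markov shift. The topology of convergence on cylinders on $\mathcal{M}_{\le 1}(\Sigma)$ is metrizable.
   Context: Let $\mathbb{N}=\{1,2,\dots\}$ and let $B=(B(i,j))_{i,j\in\mathbb{N}}$ be a matrix with entries in $\{0,1\}$ having no zero row and no zero column. The (one-sided) countable Markov shift defined by $B$ is $\Sigma=\{(x_n)_{n\in\mathbb{N}}\in\mathbb{N}^{\mathbb{N}}: B(x_n,x_{n+1})=1 \text{ for all } n\}$ with the shift map $\sigma(x_1,x_2,\dots)=(x_2,x_3,\dots)$. A cylinder of length $n$ is $[a_1\dots a_n]=\{x\in\Sigma: x_j=a_j,\ 1\le j\le n\}$; $\Sigma$ has the topology generated by cylinders. $\mathcal{M}_{\le 1}(\Sigma)$ is the set of nonnegative Borel measures $\mu$ on $\Sigma$ with $\mu(\Sigma)\le1$. A sequence $(\mu_n)_n$ in $\mathcal{M}_{\le1}(\Sigma)$ converges on cylinders to $\mu$ if $\lim_{n\to\infty}\mu_n(C)=\mu(C)$ for every cylinder $C\subset\Sigma$; the topology of convergence on cylinders is the topology induced by this convergence, i.e. the coarsest topology for which $\mu\mapsto\mu(C)$ is continuous for every cylinder $C$. *)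

theory Defs
  imports "HOL-Analysis.Analysis"
begin

text \<open>The countable alphabet \<open>{1, 2, \<dots>}\<close> is relabelled as the type \<^typ>\<open>nat\<close>, and sequences
  are indexed from 0.\<close>

definition transition_matrix :: "(nat \<Rightarrow> nat \<Rightarrow> nat) \<Rightarrow> bool" where
  "transition_matrix B \<longleftrightarrow>
     (\<forall>i j. B i j \<in> {0, 1}) \<and> (\<forall>i. \<exists>j. B i j \<noteq> 0) \<and> (\<forall>j. \<exists>i. B i j \<noteq> 0)"

definition markov_shift :: "(nat \<Rightarrow> nat \<Rightarrow> nat) \<Rightarrow> (nat \<Rightarrow> nat) set" where
  "markov_shift B = {x. \<forall>n. B (x n) (x (Suc n)) = 1}"

definition cylinder :: "(nat \<Rightarrow> nat \<Rightarrow> nat) \<Rightarrow> nat list \<Rightarrow> (nat \<Rightarrow> nat) set" where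
  "cylinder B w = {x \<in> markov_shift B. \<forall>j < length w. x j = w ! j}"

text \<open>Cylinders have positive length. Admitting the empty word would make the whole space a
  cylinder, and convergence on cylinders would then preserve the total mass. Words that are not
  admissible only contribute the empty set.\<close>

definition cylinders :: "(nat \<Rightarrow> nat \<Rightarrow> nat) \<Rightarrow> (nat \<Rightarrow> nat) set set" where
  "cylinders B = {cylinder B w | w. w \<noteq> []}"

definition markov_shift_topology :: "(nat \<Rightarrow> nat \<Rightarrow> nat) \<Rightarrow> (nat \<Rightarrow> nat) topology" where
  "markov_shift_topology B = topology_generated_by (cylinders B)"

definition markov_shift_borel :: "(nat \<Rightarrow> nat \<Rightarrow> nat) \<Rightarrow> (nat \<Rightarrow> nat) measure" where
  "markov_shift_borel B = sigma (markov_shift B) {U. openin (markov_shift_topology B) U}"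

definition subprob_measures :: "(nat \<Rightarrow> nat \<Rightarrow> nat) \<Rightarrow> (nat \<Rightarrow> nat) measure set" where
  "subprob_measures B =
     {\<mu>. sets \<mu> = sets (markov_shift_borel B) \<and> emeasure \<mu> (markov_shift B) \<le> 1}"

definition converges_on_cylinders ::
  "(nat \<Rightarrow> nat \<Rightarrow> nat) \<Rightarrow> (nat \<Rightarrow> (nat \<Rightarrow> nat) measure) \<Rightarrow> (nat \<Rightarrow> nat) measure \<Rightarrow> bool" where
  "converges_on_cylinders B \<mu>s \<mu> \<longleftrightarrow>
     (\<forall>C \<in> cylinders B. (\<lambda>n. measure (\<mu>s n) C) \<longlonglongrightarrow> measure \<mu> C)"

text \<open>The coarsest topology on the measures of total mass at most 1 for which evaluation at every
  cylinder is continuous; see the lemmas below.\<close>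

definition cylinder_topology :: "(nat \<Rightarrow> nat \<Rightarrow> nat) \<Rightarrow> (nat \<Rightarrow> nat) measure topology" where
  "cylinder_topology B = topology_generated_by
     {{\<mu> \<in> subprob_measures B. measure \<mu> C \<in> U} | C U. C \<in> cylinders B \<and> open (U :: real set)}"

lemma topspace_markov_shift_topology: "topspace (markov_shift_topology B) = markov_shift B"
proof -
  have "x \<in> cylinder B [x 0]" if "x \<in> markov_shift B" for x
    using that by (simp add: cylinder_def)
  then have "markov_shift B \<subseteq> \<Union> (cylinders B)"
    unfolding cylinders_def by blast
  moreover have "\<Union> (cylinders B) \<subseteq> markov_shift B"
    by (auto simp: cylinders_def cylinder_def)
  ultimately show ?thesis
    by (simp add: markov_shift_topology_def topology_generated_by_topspace)
qed

lemma sets_markov_shift_borel: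
  "sets (markov_shift_borel B) =
     sigma_sets (markov_shift B) {U. openin (markov_shift_topology B) U}"
  unfolding markov_shift_borel_def
  by (rule sets_measure_of) (use openin_subset topspace_markov_shift_topology in blast)

lemma cylinder_in_sets_borel:
  "C \<in> cylinders B \<Longrightarrow> C \<in> sets (markov_shift_borel B)"
  by (auto simp: sets_markov_shift_borel markov_shift_topology_def
      intro!: sigma_sets.Basic topology_generated_by_Basis)

lemma topspace_cylinder_topology: "topspace (cylinder_topology B) = subprob_measures B"
proof -
  have "cylinder B [0] \<in> cylinders B"
    unfolding cylinders_def by blast
  then have "subprob_measures B \<subseteq> \<Union> {{\<mu> \<in> subprob_measures B. measure \<mu> C \<in> U} | C U.
      C \<in> cylinders B \<and> open (U :: real set)}"
    using open_UNIV by blast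
  then show ?thesis
    by (auto simp: cylinder_topology_def topology_generated_by_topspace)
qed

lemma continuous_map_measure_cylinder:
  assumes "C \<in> cylinders B"
  shows "continuous_map (cylinder_topology B) euclideanreal (\<lambda>\<mu>. measure \<mu> C)"
  unfolding continuous_map
proof (intro conjI allI impI)
  fix U :: "real set" assume "openin euclideanreal U"
  then show "openin (cylinder_topology B)
      {\<mu> \<in> topspace (cylinder_topology B). measure \<mu> C \<in> U}"
    unfolding topspace_cylinder_topology unfolding cylinder_topology_def
    using assms by (intro topology_generated_by_Basis) auto
qed simp

lemma cylinder_topology_coarsest:
  assumes "topspace T = subprob_measures B"
    and "\<And>C. C \<in> cylinders B \<Longrightarrow> continuous_map T euclideanreal (\<lambda>\<mu>. measure \<mu> C)"
    and "openin (cylinder_topology B) V"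
  shows "openin T V"
proof -
  have "generate_topology_on
     {{\<mu> \<in> subprob_measures B. measure \<mu> C \<in> U} | C U. C \<in> cylinders B \<and> open (U :: real set)} V"
    using assms(3) by (simp add: cylinder_topology_def openin_topology_generated_by_iff)
  then show ?thesis
  proof induction
    case (Basis s)
    then obtain C and U :: "real set" where "C \<in> cylinders B" "open U"
      and s: "s = {\<mu> \<in> subprob_measures B. measure \<mu> C \<in> U}"
      by blast
    then show ?case
      using assms(2)[of C] assms(1) by (auto simp: continuous_map)
  qed auto
qed

lemma limitin_cylinder_topology_iff:
  assumes "range \<mu>s \<subseteq> subprob_measures B" "\<mu> \<in> subprob_measures B"
  shows "limitin (cylinder_topology B) \<mu>s \<mu> sequentially \<longleftrightarrow> converges_on_cylinders B \<mu>s \<mu>"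
proof
  assume "limitin (cylinder_topology B) \<mu>s \<mu> sequentially"
  then show "converges_on_cylinders B \<mu>s \<mu>"
    unfolding converges_on_cylinders_def
    using continuous_map_limit[OF continuous_map_measure_cylinder] by (fastforce simp: o_def)
next
  assume conv: "converges_on_cylinders B \<mu>s \<mu>"
  have "eventually (\<lambda>n. \<mu>s n \<in> V) sequentially"
    if "openin (cylinder_topology B) V" "\<mu> \<in> V" for V
  proof -
    have "generate_topology_on {{\<mu> \<in> subprob_measures B. measure \<mu> C \<in> U} | C U.
        C \<in> cylinders B \<and> open (U :: real set)} V"
      using that(1) by (simp add: cylinder_topology_def openin_topology_generated_by_iff)
    then show ?thesis
      using that(2)
    proof induction
      case (Int a b)
      then show ?case by (auto intro: eventually_conj)
    next
      case (UN K)
      then obtain k where "k \<in> K" "\<mu> \<in> k" by blast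
      with UN.IH have "eventually (\<lambda>n. \<mu>s n \<in> k) sequentially" by blast
      with \<open>k \<in> K\<close> show ?case by (auto elim: eventually_mono)
    next
      case (Basis s)
      then obtain C and U :: "real set" where C: "C \<in> cylinders B" and U: "open U"
        and s: "s = {\<mu> \<in> subprob_measures B. measure \<mu> C \<in> U}"
        by blast
      have "(\<lambda>n. measure (\<mu>s n) C) \<longlonglongrightarrow> measure \<mu> C"
        using conv C by (simp add: converges_on_cylinders_def)
      then have "eventually (\<lambda>n. measure (\<mu>s n) C \<in> U) sequentially"
        using U Basis(2) s by (auto dest: topological_tendstoD)
      then show ?case
        using assms(1) s by (auto elim!: eventually_mono)
    qed auto
  qed
  then show "limitin (cylinder_topology B) \<mu>s \<mu> sequentially"
    using assms(2) by (auto simp: limitin_def topspace_cylinder_topology)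
qed

end

theory Submission imports Defs begin

text \<open>Evaluation at the countably many cylinders embeds the space of subprobability measures into
  a countable power of the real line, which is metrizable. The embedding is injective because
  cylinders form a pi-system that generates the Borel sets and covers the shift space by countably
  many sets.\<close>

text \<open>The generators are the preimages of subbasic open sets of the product under the
  evaluation map, which \<open>sep\<close> makes injective. That map is therefore a homeomorphism
  onto its image, a subspace of a countable product of metric spaces.\<close>

lemma metrizable_space_initial_topology:
  fixes f :: "'i \<Rightarrow> 'a \<Rightarrow> 'b::metric_space"
  assumes "countable I"
    and sep: "\<And>x y. x \<in> S \<Longrightarrow> y \<in> S \<Longrightarrow> (\<And>i. i \<in> I \<Longrightarrow> f i x = f i y) \<Longrightarrow> x = y"
  shows "metrizable_space (topology_generated_by {{x \<in> S. f i x \<in> U} | i U. i \<in> I \<and> open U})"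
    (is "metrizable_space (topology_generated_by ?\<B>)")
proof -
  define X where "X = topology_generated_by ?\<B>"
  define P where "P = product_topology (\<lambda>_. euclidean :: 'b topology) I"
  \<comment> \<open>Points of \<open>product_topology\<close> are extensional functions, hence the
    restriction to \<open>I\<close>.\<close>
  define g where "g x = (\<lambda>i\<in>I. f i x)" for x
  have g_apply: "g x i = f i x" if "i \<in> I" for x i
    using that by (simp add: g_def)
  have topX: "topspace X = \<Union> ?\<B>"
    unfolding X_def by simp
  \<comment> \<open>Equality can fail: for empty \<open>I\<close> there are no generators and
    \<open>topspace X\<close> is empty, while \<open>S\<close> may still have one point.\<close>
  have "topspace X \<subseteq> S"
    unfolding topX by auto
  have inj: "inj_on g (topspace X)"
  proof (rule inj_onI)
    fix x y assume xy: "x \<in> topspace X" "y \<in> topspace X" "g x = g y"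
    then have "f i x = f i y" if "i \<in> I" for i
      using that by (metis g_apply)
    then show "x = y"
      using xy \<open>topspace X \<subseteq> S\<close> sep by blast
  qed
  have f_cont: "continuous_map X euclidean (f i)" if "i \<in> I" for i
    unfolding continuous_map
  proof (intro conjI allI impI)
    fix U :: "'b set" assume "openin euclidean U"
    then have *: "{x \<in> S. f i x \<in> U} \<in> ?\<B>"
      using that by auto
    then have "{x \<in> topspace X. f i x \<in> U} = {x \<in> S. f i x \<in> U}"
      using \<open>topspace X \<subseteq> S\<close> unfolding topX by blast
    then show "openin X {x \<in> topspace X. f i x \<in> U}"
      using topology_generated_by_Basis[OF *] by (simp add: X_def)
  qed simp
  have g_cont: "continuous_map X P g"
    unfolding P_def continuous_map_componentwise
    using f_cont by (auto simp: g_def)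
  define Q where "Q = subtopology P (g ` topspace X)"
  define h where "h = inv_into (topspace X) g"
  have topQ: "topspace Q = g ` topspace X"
    unfolding Q_def using continuous_map_image_subset_topspace[OF g_cont] by auto
  have h_g: "h (g x) = x" if "x \<in> topspace X" for x
    using that inj by (simp add: h_def)
  have h_cont: "continuous_map Q X h"
    unfolding X_def
  proof (rule continuous_on_generated_topo)
    fix V assume "V \<in> ?\<B>"
    then obtain i U where iU: "i \<in> I" "open U" and V: "V = {x \<in> S. f i x \<in> U}"
      by blast
    \<comment> \<open>On the image of \<open>g\<close>, pulling \<open>V\<close> back along
      \<open>h\<close> is a condition on the single coordinate \<open>i\<close>, so continuity of
      that projection suffices.\<close>
    have "continuous_map Q euclidean (\<lambda>z. z i)"
      unfolding Q_def P_def
      by (intro continuous_map_from_subtopology continuous_map_product_projection iU)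
    then have "openin Q {z \<in> topspace Q. z i \<in> U}"
      using iU by (auto simp: continuous_map)
    moreover have "h (g x) \<in> V \<longleftrightarrow> g x i \<in> U" if "x \<in> topspace X" for x
      using that iU \<open>topspace X \<subseteq> S\<close> by (auto simp: V h_g g_apply)
    then have "h -` V \<inter> topspace Q = {z \<in> topspace Q. z i \<in> U}"
      unfolding topQ by blast
    ultimately show "openin Q (h -` V \<inter> topspace Q)"
      by simp
  next
    show "h ` topspace Q \<subseteq> \<Union> ?\<B>"
      using h_g unfolding topX[symmetric] topQ by auto
  qed
  have "homeomorphic_maps X Q g h"
    unfolding homeomorphic_maps_def
    using g_cont h_cont h_g by (auto simp: topQ) (auto simp: Q_def continuous_map_in_subtopology)
  moreover have "metrizable_space P"
    unfolding P_def metrizable_space_product_topology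
    using \<open>countable I\<close> by (auto simp: metrizable_space_euclidean intro: countable_subset)
  then have "metrizable_space Q"
    unfolding Q_def by (rule metrizable_space_subtopology)
  ultimately have "metrizable_space X"
    using homeomorphic_maps_imp_homeomorphic_space homeomorphic_metrizable_space by metis
  then show ?thesis
    by (simp add: X_def)
qed

text \<open>Finite intersections of generators form a base. Requiring \<open>F \<noteq> {}\<close>
  excludes the intersection \<open>UNIV\<close>, which need not lie in a sigma-algebra on a smaller
  set \<open>\<Omega>\<close>.\<close>

lemma topology_generated_by_finite_Inter:
  assumes "openin (topology_generated_by S) V" "x \<in> V"
  shows "\<exists>F. finite F \<and> F \<noteq> {} \<and> F \<subseteq> S \<and> x \<in> \<Inter> F \<and> \<Inter> F \<subseteq> V"
  using openin_topology_generated_by[OF assms(1)] assms(2)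
proof induction
  case (Int a b)
  then obtain F G where "finite F" "F \<noteq> {}" "F \<subseteq> S" "x \<in> \<Inter> F" "\<Inter> F \<subseteq> a"
    "finite G" "G \<subseteq> S" "x \<in> \<Inter> G" "\<Inter> G \<subseteq> b"
    by (metis IntD1 IntD2)
  then show ?case
    by (intro exI[of _ "F \<union> G"]) auto
next
  case (UN K)
  then show ?case
    by (meson Union_iff Union_upper order_trans)
next
  case (Basis s)
  then show ?case
    by (intro exI[of _ "{s}"]) auto
qed simp

text \<open>A countable subbasis has only countably many finite subfamilies, so every open set is a
  countable union of finite intersections of generators.\<close>

lemma sigma_sets_topology_generated_by:
  assumes "countable S" "S \<subseteq> Pow \<Omega>"
  shows "sigma_sets \<Omega> {U. openin (topology_generated_by S) U} = sigma_sets \<Omega> S"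
proof (rule sigma_sets_eqI)
  interpret sigma_algebra \<Omega> "sigma_sets \<Omega> S"
    using assms(2) by (rule sigma_algebra_sigma_sets)
  fix V assume "V \<in> {U. openin (topology_generated_by S) U}"
  then have V: "openin (topology_generated_by S) V"
    by simp
  \<comment> \<open>Taking all families that fit inside \<open>V\<close> avoids choosing one for
    each point of \<open>V\<close>.\<close>
  define \<F> where "\<F> = {F. finite F \<and> F \<subseteq> S \<and> F \<noteq> {} \<and> \<Inter> F \<subseteq> V}"
  have "countable \<F>"
    using countable_Collect_finite_subset[OF assms(1)]
    by (rule countable_subset[rotated]) (auto simp: \<F>_def)
  moreover have "\<Inter> F \<in> sigma_sets \<Omega> S" if "F \<in> \<F>" for F
    using that finite_INT[of F "\<lambda>A. A"] by (auto simp: \<F>_def)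
  ultimately have "(\<Union>F\<in>\<F>. \<Inter> F) \<in> sigma_sets \<Omega> S"
    by (intro countable_UN') auto
  moreover have "V = (\<Union>F\<in>\<F>. \<Inter> F)"
  proof
    show "V \<subseteq> (\<Union>F\<in>\<F>. \<Inter> F)"
    proof
      fix x assume "x \<in> V"
      from topology_generated_by_finite_Inter[OF V this] show "x \<in> (\<Union>F\<in>\<F>. \<Inter> F)"
        unfolding \<F>_def by blast
    qed
    show "(\<Union>F\<in>\<F>. \<Inter> F) \<subseteq> V"
      unfolding \<F>_def by blast
  qed
  ultimately show "V \<in> sigma_sets \<Omega> S"
    by simp
next
  fix C assume "C \<in> S"
  then show "C \<in> sigma_sets \<Omega> {U. openin (topology_generated_by S) U}"
    by (intro sigma_sets.Basic) (auto intro: topology_generated_by_Basis)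
qed

lemma countable_cylinders: "countable (cylinders B)"
proof -
  have "cylinders B = cylinder B ` {w. w \<noteq> []}"
    unfolding cylinders_def by blast
  then show ?thesis
    by simp
qed

lemma cylinder_subset_markov_shift: "C \<in> cylinders B \<Longrightarrow> C \<subseteq> markov_shift B"
  by (auto simp: cylinders_def cylinder_def)

text \<open>A common point forces the shorter word to be a prefix of the longer one; so two
  cylinders are nested or disjoint.\<close>

lemma cylinder_Int_subset:
  assumes "length v \<le> length w" "cylinder B v \<inter> cylinder B w \<noteq> {}"
  shows "cylinder B w \<subseteq> cylinder B v"
proof -
  obtain z where "z \<in> cylinder B v" "z \<in> cylinder B w"
    using assms(2) by blast
  then have "v ! j = w ! j" if "j < length v" for j
    using that assms(1) by (auto simp: cylinder_def)
  then show ?thesis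
    using assms(1) by (auto simp: cylinder_def)
qed

text \<open>The empty set has to be added: in the full shift no cylinder is empty, yet distinct
  cylinders of equal length are disjoint.\<close>

lemma Int_stable_cylinders: "Int_stable (insert {} (cylinders B))"
proof -
  have "C \<inter> D \<in> insert {} (cylinders B)" if CD: "C \<in> cylinders B" "D \<in> cylinders B" for C D
  proof -
    obtain v w where vw: "C = cylinder B v" "D = cylinder B w"
      using CD by (auto simp: cylinders_def)
    consider "C \<inter> D = {}" | "D \<subseteq> C" | "C \<subseteq> D"
      using cylinder_Int_subset[of v w B] cylinder_Int_subset[of w v B]
      unfolding vw by (metis Int_commute linear)
    then show ?thesis
      using CD by cases (auto simp: Int_absorb1 Int_absorb2)
  qed
  then show ?thesis
    by (auto simp: Int_stable_def)
qed

lemma sets_markov_shift_borel_eq_sigma_cylinders: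
  "sets (markov_shift_borel B) = sigma_sets (markov_shift B) (cylinders B)"
  unfolding sets_markov_shift_borel markov_shift_topology_def
  by (intro sigma_sets_topology_generated_by countable_cylinders)
    (use cylinder_subset_markov_shift in blast)

lemma Union_cylinders: "\<Union> (cylinders B) = markov_shift B"
  using topspace_markov_shift_topology[of B] by (simp add: markov_shift_topology_def)

text \<open>Since the whole space need not be a cylinder, equality of total masses is not given.
  Uniqueness on a pi-system is therefore used in the form with a countable cover by sets of finite
  measure, here the cylinders.\<close>

lemma subprob_measures_eqI:
  assumes "\<mu> \<in> subprob_measures B" "\<nu> \<in> subprob_measures B"
    and eq: "\<And>C. C \<in> cylinders B \<Longrightarrow> measure \<mu> C = measure \<nu> C"
  shows "\<mu> = \<nu>"
proof (rule measure_eqI_generator_eq_countable)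
  let ?E = "insert {} (cylinders B)"
  \<comment> \<open>Because \<open>measure\<close> sends infinite values to 0, equality of the real
    values gives equality of \<open>emeasure\<close> only once finiteness is known.\<close>
  have fin: "emeasure \<rho> C \<noteq> \<infinity>" if "\<rho> \<in> subprob_measures B" "C \<in> cylinders B" for \<rho> C
  proof -
    have sets: "sets \<rho> = sets (markov_shift_borel B)" and "emeasure \<rho> (markov_shift B) \<le> 1"
      using that(1) by (auto simp: subprob_measures_def)
    moreover have "markov_shift B \<in> sets \<rho>"
      unfolding sets sets_markov_shift_borel by (rule sigma_sets_top)
    then have "emeasure \<rho> C \<le> emeasure \<rho> (markov_shift B)"
      using cylinder_subset_markov_shift[OF that(2)] by (rule emeasure_mono[rotated])
    ultimately show ?thesis
      by (auto simp: top_unique)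
  qed
  show "Int_stable ?E"
    by (rule Int_stable_cylinders)
  show "?E \<subseteq> Pow (markov_shift B)"
    using cylinder_subset_markov_shift by blast
  show "emeasure \<mu> C = emeasure \<nu> C" if "C \<in> ?E" for C
    using that fin assms by (auto simp: emeasure_eq_ennreal_measure)
  have "sigma_sets (markov_shift B) ?E = sigma_sets (markov_shift B) (cylinders B)"
    by (rule sigma_sets_eqI) (auto intro: sigma_sets.Empty)
  then show "sets \<mu> = sigma_sets (markov_shift B) ?E" "sets \<nu> = sigma_sets (markov_shift B) ?E"
    using assms sets_markov_shift_borel_eq_sigma_cylinders by (auto simp: subprob_measures_def)
  show "cylinders B \<subseteq> ?E"
    by blast
  show "\<Union> (cylinders B) = markov_shift B"
    by (rule Union_cylinders)
  show "countable (cylinders B)"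
    by (rule countable_cylinders)
  show "emeasure \<mu> C \<noteq> \<infinity>" if "C \<in> cylinders B" for C
    using assms(1) that by (rule fin)
qed

theorem proposition3p15:
  fixes B :: "nat \<Rightarrow> nat \<Rightarrow> nat"
  assumes "transition_matrix B"
  shows "metrizable_space (cylinder_topology B)"
  unfolding cylinder_topology_def
  \<comment> \<open>The cylinders serve as the countable index set \<open>I\<close>, the measures of
    mass at most 1 as \<open>S\<close>, and \<open>subprob_measures_eqI\<close> supplies
    \<open>sep\<close>.\<close>
  by (rule metrizable_space_initial_topology[where f = "\<lambda>C \<mu>. measure \<mu> C"])
    (use countable_cylinders subprob_measures_eqI in auto)

end
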